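(* Let $p,z\in\mathbb{R}^n$ with $\delta:=p^{\top}z\neq 0$ and let $\tau_{\min}\in\mathbb{R}$. Define $$\lambda:=\frac{1}{2}\left(|p|^2+|z|^2-\sqrt{(|p|^2-|z|^2)^2+4\delta^2}\right),\qquad \tau^{\mathrm{Du}}:=\max\left\{\frac{|z|^2-\lambda}{\delta},\ \tau_{\min}\right\}.$$ Then $\tau^{\mathrm{Du}}$ is the optimal scaling parameter obtained by rescaling a minimizer of the total least squares problem: if $\eta=(\eta_1,\eta_2)\in\mathbb{R}^2$ minimizes $|\eta_1 p-\eta_2 z|$ subject to $|\eta|=1$, then $\eta_2\neq 0$ and $\tau^{\mathrm{Du}}=\max\{\eta_1/\eta_2,\tau_{\min}\}$. Moreover, with $$\tau^{\mathrm{Dp}}:=\max\left\{\frac{p^{\top}z}{p^{\top}p},\ \tau_{\min}\right\},\qquad \tau^{\mathrm{Dz}}:=\max\left\{\frac{z^{\top}z}{p^{\top}z},\ \tau_{\min}\right\},$$ it holds that $|\tau^{\mathrm{Dp}}|\le|\tau^{\mathrm{Du}}|\le|\tau^{\mathrm{Dz}}|$.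
   Context: $|\cdot|$ denotes the Euclidean norm of a vector and the absolute value of a real number. The scalar $\tau$ is a scaling parameter sought so that the equation $\tau p-z=0$ holds in a total least squares sense, subject to the lower bound $\tau\ge\tau_{\min}$. *)

theory Defs
  imports "HOL-Analysis.Analysis"
begin

definition tls_lambda :: "real ^ 'n \<Rightarrow> real ^ 'n \<Rightarrow> real" where
  "tls_lambda p z =
     1 / 2 * ((norm p)\<^sup>2 + (norm z)\<^sup>2
       - sqrt (((norm p)\<^sup>2 - (norm z)\<^sup>2)\<^sup>2 + 4 * (p \<bullet> z)\<^sup>2))"

definition tau_Du :: "real \<Rightarrow> real ^ 'n \<Rightarrow> real ^ 'n \<Rightarrow> real" where
  "tau_Du \<tau>_min p z = max (((norm z)\<^sup>2 - tls_lambda p z) / (p \<bullet> z)) \<tau>_min"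

definition tau_Dp :: "real \<Rightarrow> real ^ 'n \<Rightarrow> real ^ 'n \<Rightarrow> real" where
  "tau_Dp \<tau>_min p z = max ((p \<bullet> z) / (p \<bullet> p)) \<tau>_min"

definition tau_Dz :: "real \<Rightarrow> real ^ 'n \<Rightarrow> real ^ 'n \<Rightarrow> real" where
  "tau_Dz \<tau>_min p z = max ((z \<bullet> z) / (p \<bullet> z)) \<tau>_min"

definition tls_minimizer :: "real ^ 'n \<Rightarrow> real ^ 'n \<Rightarrow> real ^ 2 \<Rightarrow> bool" where
  "tls_minimizer p z \<eta> \<longleftrightarrow>
     is_arg_min (\<lambda>\<xi>. norm (\<xi> $ 1 *\<^sub>R p - \<xi> $ 2 *\<^sub>R z)) (\<lambda>\<xi>. norm \<xi> = 1) \<eta>"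

end

theory Submission imports Defs
begin

text \<open>
  Write \<open>a\<close> and \<open>b\<close> for the squared norms of \<open>p\<close> and \<open>z\<close>, and \<open>d\<close> for their inner product. The squared
  objective is the quadratic form of the symmetric matrix with rows \<open>(a, -d)\<close> and \<open>(-d, b)\<close>, whose
  smaller eigenvalue is \<open>\<lambda> = tls_lambda p z\<close>. On the unit circle its minimum is \<open>\<lambda>\<close>, attained exactly
  on the eigenspace. As \<open>d \<noteq> 0\<close>, that eigenspace is the line \<open>d \<eta>\<^sub>1 = (b - \<lambda>) \<eta>\<^sub>2\<close>, which gives
  the first claim. Instead of invoking spectral theory, \<open>quadratic_form_complete_square\<close> exhibits
  the form minus \<open>\<lambda> (\<eta>\<^sub>1\<^sup>2 + \<eta>\<^sub>2\<^sup>2)\<close> as a positive multiple of the square of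
  \<open>d \<eta>\<^sub>1 - (b - \<lambda>) \<eta>\<^sub>2\<close>.

  For the chain of inequalities, the characteristic equation \<open>(a - \<lambda>) (b - \<lambda>) = d\<^sup>2\<close> rewrites the
  unconstrained scaling \<open>(b - \<lambda>) / d\<close> as \<open>d / (a - \<lambda>)\<close>. By Cauchy-Schwarz the matrix is positive
  semidefinite, so \<open>\<lambda> \<ge> 0\<close>: the first form shows that the scaling is at most \<open>b / d\<close> in absolute
  value, the second that it is at least \<open>d / a\<close>. All three numbers have the sign of \<open>d\<close>, and for
  numbers of equal sign the truncation at a lower bound respects the order of absolute values
  (\<open>abs_max_mono\<close>).
\<close>

text \<open>
  The larger eigenvalue is at least the larger diagonal entry, and strictly so when \<open>d \<noteq> 0\<close>;
  since the two eigenvalues sum to \<open>a + b\<close>, the smaller one lies strictly below both entries.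
\<close>
lemma smaller_eigenvalue:
  fixes a b d :: real
  assumes "d \<noteq> 0"
  defines "l \<equiv> 1 / 2 * (a + b - sqrt ((a - b)\<^sup>2 + 4 * d\<^sup>2))"
  shows "l < a" and "l < b" and "(a - l) * (b - l) = d\<^sup>2"
proof -
  define s where "s = sqrt ((a - b)\<^sup>2 + 4 * d\<^sup>2)"
  have l: "l = (a + b - s) / 2"
    by (simp add: l_def s_def)
  have s2: "s\<^sup>2 = (a - b)\<^sup>2 + 4 * d\<^sup>2"
    by (simp add: s_def)
  have "sqrt ((a - b)\<^sup>2) < s"
    unfolding s_def using assms(1) by (intro real_sqrt_less_mono) simp
  then have "\<bar>a - b\<bar> < s"
    by simp
  then show "l < a" "l < b"
    by (auto simp: l)
  have "(a - l) * (b - l) = (s\<^sup>2 - (a - b)\<^sup>2) / 4"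
    by (simp add: l power2_eq_square field_simps)
  then show "(a - l) * (b - l) = d\<^sup>2"
    by (simp add: s2)
qed

lemma tls_lambda_nonneg: "0 \<le> tls_lambda p z"
proof -
  have "(p \<bullet> z)\<^sup>2 \<le> (norm p)\<^sup>2 * (norm z)\<^sup>2"
    using Cauchy_Schwarz_ineq[of p z] by (simp add: power2_norm_eq_inner)
  then have "((norm p)\<^sup>2 - (norm z)\<^sup>2)\<^sup>2 + 4 * (p \<bullet> z)\<^sup>2 \<le> ((norm p)\<^sup>2 + (norm z)\<^sup>2)\<^sup>2"
    by (simp add: power2_sum power2_diff)
  then have "sqrt (((norm p)\<^sup>2 - (norm z)\<^sup>2)\<^sup>2 + 4 * (p \<bullet> z)\<^sup>2) \<le> (norm p)\<^sup>2 + (norm z)\<^sup>2"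
    by (intro real_le_lsqrt) auto
  then show ?thesis
    by (simp add: tls_lambda_def)
qed

text \<open>
  The characteristic equation says that the matrix shifted by its eigenvalue \<open>l\<close> is singular, so
  that the shifted form has rank one and completing the square leaves no remainder.
\<close>
lemma quadratic_form_complete_square:
  fixes a b d l x y :: real
  assumes "(a - l) * (b - l) = d\<^sup>2"
  shows "(b - l) * (a * x\<^sup>2 - 2 * d * x * y + b * y\<^sup>2 - l * (x\<^sup>2 + y\<^sup>2)) = (d * x - (b - l) * y)\<^sup>2"
proof -
  have "(b - l) * (a * x\<^sup>2 - 2 * d * x * y + b * y\<^sup>2 - l * (x\<^sup>2 + y\<^sup>2))
      = ((a - l) * (b - l)) * x\<^sup>2 - 2 * (d * x) * ((b - l) * y) + ((b - l) * y)\<^sup>2"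
    by (simp add: power2_eq_square algebra_simps)
  also have "\<dots> = (d * x - (b - l) * y)\<^sup>2"
    unfolding assms by (simp add: power2_diff power_mult_distrib)
  finally show ?thesis .
qed

lemma norm_power2_vec2: "(norm \<xi>)\<^sup>2 = (\<xi> $ 1)\<^sup>2 + (\<xi> $ 2)\<^sup>2" for \<xi> :: "real ^ 2"
  by (simp add: power2_norm_eq_inner inner_vec_def sum_2 power2_eq_square[symmetric])

lemma norm_power2_combination:
  fixes p z :: "'a::real_inner"
  shows "(norm (x *\<^sub>R p - y *\<^sub>R z))\<^sup>2
    = (norm p)\<^sup>2 * x\<^sup>2 - 2 * (p \<bullet> z) * x * y + (norm z)\<^sup>2 * y\<^sup>2"
  unfolding power2_norm_eq_inner
  by (simp add: inner_diff_left inner_diff_right inner_commute[of z p] power2_eq_square algebra_simps)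

text \<open>
  A minimizer does at least as well as the normalized eigenvector \<open>(b - \<lambda>, d)\<close>, for which the
  completed square vanishes; hence the square vanishes for the minimizer as well, which puts it on
  the same line.
\<close>
lemma tls_minimizer_eigenvector:
  fixes p z :: "real ^ 'n"
  assumes d: "p \<bullet> z \<noteq> 0" and min: "tls_minimizer p z \<eta>"
  shows "(p \<bullet> z) * \<eta> $ 1 = ((norm z)\<^sup>2 - tls_lambda p z) * \<eta> $ 2"
proof -
  define l where "l = tls_lambda p z"
  define c where "c = (norm z)\<^sup>2 - l"
  define f where "f = (\<lambda>\<xi> :: real ^ 2. norm (\<xi> $ 1 *\<^sub>R p - \<xi> $ 2 *\<^sub>R z))"
  have c: "0 < c" and char: "((norm p)\<^sup>2 - l) * ((norm z)\<^sup>2 - l) = (p \<bullet> z)\<^sup>2"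
    using smaller_eigenvalue[OF d] by (simp_all add: c_def l_def tls_lambda_def)
  have square: "c * ((f \<xi>)\<^sup>2 - l) = ((p \<bullet> z) * \<xi> $ 1 - c * \<xi> $ 2)\<^sup>2" if "norm \<xi> = 1" for \<xi> :: "real ^ 2"
    using quadratic_form_complete_square[OF char, of "\<xi> $ 1" "\<xi> $ 2"] that norm_power2_vec2[of \<xi>]
    by (simp add: f_def c_def norm_power2_combination)
  define w :: "real ^ 2" where "w = vector [c, p \<bullet> z]"
  define v where "v = w /\<^sub>R norm w"
  have "w $ 2 \<noteq> 0"
    using d by (simp add: w_def)
  then have "w \<noteq> 0"
    by auto
  then have v: "norm v = 1"
    by (simp add: v_def)
  have "(p \<bullet> z) * v $ 1 - c * v $ 2 = 0"
    by (simp add: v_def w_def)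
  with square[OF v] c have fv: "(f v)\<^sup>2 = l"
    by simp
  have \<eta>: "norm \<eta> = 1" and "f \<eta> \<le> f v"
    using min v by (auto simp: tls_minimizer_def is_arg_min_linorder f_def)
  then have "(f \<eta>)\<^sup>2 \<le> (f v)\<^sup>2"
    by (intro power_mono) (auto simp: f_def)
  then have "c * ((f \<eta>)\<^sup>2 - l) \<le> 0"
    using c fv by (simp add: mult_le_0_iff)
  then show ?thesis
    using square[OF \<eta>] by (simp add: c_def l_def)
qed

lemma tls_minimizer_ratio:
  fixes p z :: "real ^ 'n"
  assumes d: "p \<bullet> z \<noteq> 0" and min: "tls_minimizer p z \<eta>"
  shows "\<eta> $ 2 \<noteq> 0" and "\<eta> $ 1 / \<eta> $ 2 = ((norm z)\<^sup>2 - tls_lambda p z) / (p \<bullet> z)"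
proof -
  note line = tls_minimizer_eigenvector[OF d min]
  show nz: "\<eta> $ 2 \<noteq> 0"
  proof
    assume "\<eta> $ 2 = 0"
    moreover from this have "\<eta> $ 1 = 0"
      using line d by simp
    ultimately have "norm \<eta> = 0"
      using norm_power2_vec2[of \<eta>] by simp
    then show False
      using min by (simp add: tls_minimizer_def is_arg_min_linorder)
  qed
  show "\<eta> $ 1 / \<eta> $ 2 = ((norm z)\<^sup>2 - tls_lambda p z) / (p \<bullet> z)"
    using line d nz by (simp add: frac_eq_eq mult.commute)
qed

text \<open>
  For nonnegative numbers this is the monotonicity of \<open>max\<close>. For nonpositive numbers the order of
  absolute values is the reverse of the order of the numbers: a bound \<open>t \<ge> 0\<close> makes both truncations
  equal to \<open>t\<close>, while for \<open>t < 0\<close> both stay nonpositive and \<open>max\<close> keeps the reversed order.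
\<close>
lemma abs_max_mono:
  fixes x y t :: real
  assumes "0 \<le> x * y" and "\<bar>x\<bar> \<le> \<bar>y\<bar>"
  shows "\<bar>max x t\<bar> \<le> \<bar>max y t\<bar>"
  using assms by (auto simp: zero_le_mult_iff max_def)

theorem lemma2:
  fixes p z :: "real ^ 'n" and \<tau>_min :: real
  assumes "p \<bullet> z \<noteq> 0"
  shows "(\<forall>\<eta>. tls_minimizer p z \<eta> \<longrightarrow>
            \<eta> $ 2 \<noteq> 0 \<and> tau_Du \<tau>_min p z = max (\<eta> $ 1 / \<eta> $ 2) \<tau>_min) \<and>
         \<bar>tau_Dp \<tau>_min p z\<bar> \<le> \<bar>tau_Du \<tau>_min p z\<bar> \<and>
         \<bar>tau_Du \<tau>_min p z\<bar> \<le> \<bar>tau_Dz \<tau>_min p z\<bar>"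
proof (intro conjI allI impI)
  fix \<eta> assume "tls_minimizer p z \<eta>"
  note ratio = tls_minimizer_ratio[OF assms this]
  show "\<eta> $ 2 \<noteq> 0"
    by (rule ratio)
  show "tau_Du \<tau>_min p z = max (\<eta> $ 1 / \<eta> $ 2) \<tau>_min"
    by (simp add: tau_Du_def ratio)
next
  define a b d l where "a = (norm p)\<^sup>2" and "b = (norm z)\<^sup>2" and "d = p \<bullet> z" and "l = tls_lambda p z"
  have d: "d \<noteq> 0"
    using assms by (simp add: d_def)
  have l: "0 \<le> l" "l < a" "l < b" "(a - l) * (b - l) = d\<^sup>2"
    using smaller_eigenvalue[OF assms] tls_lambda_nonneg[of p z]
    by (simp_all add: a_def b_def d_def l_def tls_lambda_def)
  have flip: "(b - l) / d = d / (a - l)"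
    using l d by (simp add: field_simps power2_eq_square)
  have "0 \<le> d / a * ((b - l) / d)" and "\<bar>d / a\<bar> \<le> \<bar>(b - l) / d\<bar>"
    using l d unfolding flip by (auto simp: abs_divide intro!: divide_left_mono mult_nonneg_nonneg)
  then show "\<bar>tau_Dp \<tau>_min p z\<bar> \<le> \<bar>tau_Du \<tau>_min p z\<bar>"
    unfolding tau_Dp_def tau_Du_def power2_norm_eq_inner[symmetric]
    by (intro abs_max_mono) (simp_all add: a_def b_def d_def l_def)
  have "0 \<le> (b - l) / d * (b / d)" and "\<bar>(b - l) / d\<bar> \<le> \<bar>b / d\<bar>"
    using l d by (auto simp: abs_divide intro!: divide_right_mono)
  then show "\<bar>tau_Du \<tau>_min p z\<bar> \<le> \<bar>tau_Dz \<tau>_min p z\<bar>"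
    unfolding tau_Du_def tau_Dz_def power2_norm_eq_inner[symmetric]
    by (intro abs_max_mono) (simp_all add: b_def d_def l_def)
qed

end
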